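(* Let $E$ be a good semistable elliptic curve over $\mathbb{Q}$ with minimal discriminant $\Delta\equiv 0 \bmod 6$. Let $c_4$ and $c_6$ be the invariants associated to a global minimal model of $E$. Then $(1728\Delta,\,c_6^2,\,c_4^3)$ is a good $ABC$ triple.
   Context: An $ABC$ triple is a triple $(a,b,c)$ of integers with $a+b=c$ and $\gcd(a,b,c)=1$. It is good if $\operatorname{rad}(abc)<\max\{|a|,|b|,|c|\}$, where $\operatorname{rad}(n)$ is the product of the distinct primes dividing $n$. An elliptic curve $E/\mathbb{Q}$ is good if $N_E^6<\max\{|c_4^3|,c_6^2\}$, where $N_E$ is the conductor of $E$ and $c_4,c_6$ are the usual invariants of a global minimal model of $E$. The minimal discriminant $\Delta$ is the discriminant of a global minimal model; one has $c_4^3-c_6^2=1728\Delta$. $E$ is semistable if it has additive reduction at no prime. *)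

theory Defs
  imports
    "HOL-Number_Theory.Number_Theory"
    "HOL-Library.FuncSet"
    "HOL-Algebra.Ideal_Product"
    "HOL-Algebra.Generated_Fields"
    "HOL-Algebra.Algebraic_Closure_Type"
    Complex_Main
begin

hide_const (open) Divisibility.prime

section \<open>Good ABC triples\<close>

text \<open>Here \<open>rad 0 = 1\<close>. The only coprime triples with \<open>a + b = c\<close> containing a zero have
  entries in \<open>{0, 1, -1}\<close>, hence maximum \<open>1\<close>, and are not good under this convention.\<close>

definition rad :: "int \<Rightarrow> int" where
  "rad n = \<Prod>(prime_factors n)"

definition abc_triple :: "int \<Rightarrow> int \<Rightarrow> int \<Rightarrow> bool" where
  "abc_triple a b c \<longleftrightarrow> a + b = c \<and> Gcd {a, b, c} = 1"

definition good_abc_triple :: "int \<Rightarrow> int \<Rightarrow> int \<Rightarrow> bool" where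
  "good_abc_triple a b c \<longleftrightarrow>
     abc_triple a b c \<and> rad (a * b * c) < Max {\<bar>a\<bar>, \<bar>b\<bar>, \<bar>c\<bar>}"


section \<open>Weierstrass equations\<close>

text \<open>\<open>y\<^sup>2 + a1 x y + a3 y = x\<^sup>3 + a2 x\<^sup>2 + a4 x + a6\<close>\<close>

datatype 'a weierstrass = Weierstrass (a1: 'a) (a2: 'a) (a3: 'a) (a4: 'a) (a6: 'a)

definition b2 :: "'a::comm_ring_1 weierstrass \<Rightarrow> 'a" where
  "b2 W = a1 W ^ 2 + 4 * a2 W"

definition b4 :: "'a::comm_ring_1 weierstrass \<Rightarrow> 'a" where
  "b4 W = 2 * a4 W + a1 W * a3 W"

definition b6 :: "'a::comm_ring_1 weierstrass \<Rightarrow> 'a" where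
  "b6 W = a3 W ^ 2 + 4 * a6 W"

definition b8 :: "'a::comm_ring_1 weierstrass \<Rightarrow> 'a" where
  "b8 W = a1 W ^ 2 * a6 W + 4 * a2 W * a6 W - a1 W * a3 W * a4 W + a2 W * a3 W ^ 2 - a4 W ^ 2"

definition c4 :: "'a::comm_ring_1 weierstrass \<Rightarrow> 'a" where
  "c4 W = b2 W ^ 2 - 24 * b4 W"

definition c6 :: "'a::comm_ring_1 weierstrass \<Rightarrow> 'a" where
  "c6 W = - (b2 W ^ 3) + 36 * b2 W * b4 W - 216 * b6 W"

definition discriminant :: "'a::comm_ring_1 weierstrass \<Rightarrow> 'a" where
  "discriminant W =
     - (b2 W ^ 2 * b8 W) - 8 * b4 W ^ 3 - 27 * b6 W ^ 2 + 9 * b2 W * b4 W * b6 W"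

definition elliptic_curve :: "'a::field weierstrass \<Rightarrow> bool" where
  "elliptic_curve E \<longleftrightarrow> discriminant E \<noteq> 0"

text \<open>The substitution \<open>x = u\<^sup>2 x' + r\<close>, \<open>y = u\<^sup>3 y' + s u\<^sup>2 x' + t\<close> transforms \<open>W\<close> into \<open>W'\<close>.\<close>

definition isomorphic :: "'a::field weierstrass \<Rightarrow> 'a weierstrass \<Rightarrow> bool" where
  "isomorphic W W' \<longleftrightarrow> (\<exists>u r s t. u \<noteq> 0 \<and>
     u * a1 W' = a1 W + 2 * s \<and>
     u ^ 2 * a2 W' = a2 W - s * a1 W + 3 * r - s ^ 2 \<and>
     u ^ 3 * a3 W' = a3 W + r * a1 W + 2 * t \<and>
     u ^ 4 * a4 W' = a4 W - s * a3 W + 2 * r * a2 W - (t + r * s) * a1 W + 3 * r ^ 2 - 2 * s * t \<and>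
     u ^ 6 * a6 W' = a6 W + r * a4 W + r ^ 2 * a2 W + r ^ 3 - t * a3 W - t ^ 2 - r * t * a1 W)"


section \<open>Minimal models over the rationals\<close>

definition integral_model :: "rat weierstrass \<Rightarrow> int weierstrass \<Rightarrow> bool" where
  "integral_model E M \<longleftrightarrow> isomorphic E (map_weierstrass of_int M)"

text \<open>It suffices to compare with models that are integral at every prime: a model that is merely
  \<open>p\<close>-integral becomes integral after scaling by some \<open>u\<close> prime to \<open>p\<close>, which does not change
  the \<open>p\<close>-adic valuation of its discriminant.\<close>

definition minimal_model_at :: "nat \<Rightarrow> rat weierstrass \<Rightarrow> int weierstrass \<Rightarrow> bool" where
  "minimal_model_at p E M \<longleftrightarrow> integral_model E M \<and>
     (\<forall>M'. integral_model E M' \<longrightarrow>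
        multiplicity (int p) (discriminant M) \<le> multiplicity (int p) (discriminant M'))"

definition global_minimal_model :: "rat weierstrass \<Rightarrow> int weierstrass \<Rightarrow> bool" where
  "global_minimal_model E M \<longleftrightarrow>
     integral_model E M \<and> (\<forall>p. prime p \<longrightarrow> minimal_model_at p E M)"

definition minimal_discriminant :: "rat weierstrass \<Rightarrow> int" where
  "minimal_discriminant E = (THE D. \<exists>M. global_minimal_model E M \<and> D = discriminant M)"


section \<open>Reduction types\<close>

text \<open>The affine equation \<open>weierstrass_poly W x y = 0\<close> and the two partial derivatives of its
  left-hand side.\<close>

definition weierstrass_poly :: "'a::comm_ring_1 weierstrass \<Rightarrow> 'a \<Rightarrow> 'a \<Rightarrow> 'a" where
  "weierstrass_poly W x y =
     y ^ 2 + a1 W * x * y + a3 W * y - (x ^ 3 + a2 W * x ^ 2 + a4 W * x + a6 W)"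

definition weierstrass_poly_dx :: "'a::comm_ring_1 weierstrass \<Rightarrow> 'a \<Rightarrow> 'a \<Rightarrow> 'a" where
  "weierstrass_poly_dx W x y = a1 W * y - (3 * x ^ 2 + 2 * a2 W * x + a4 W)"

definition weierstrass_poly_dy :: "'a::comm_ring_1 weierstrass \<Rightarrow> 'a \<Rightarrow> 'a \<Rightarrow> 'a" where
  "weierstrass_poly_dy W x y = 2 * y + a1 W * x + a3 W"

text \<open>The point at infinity is always smooth. A singular Weierstrass cubic over the algebraic
  closure of \<open>F\<^sub>p\<close> has exactly one singular point, which is therefore Galois invariant and, as
  \<open>F\<^sub>p\<close> is perfect, has coordinates in \<open>F\<^sub>p\<close>. So it is enough to look for singular points there.\<close>

definition singular_point_mod :: "nat \<Rightarrow> int weierstrass \<Rightarrow> int \<Rightarrow> int \<Rightarrow> bool" where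
  "singular_point_mod p M x y \<longleftrightarrow>
     [weierstrass_poly M x y = 0] (mod int p) \<and>
     [weierstrass_poly_dx M x y = 0] (mod int p) \<and>
     [weierstrass_poly_dy M x y = 0] (mod int p)"

text \<open>At a singular point \<open>(x, y)\<close>, the quadratic part of the Taylor expansion of
  \<open>weierstrass_poly M\<close> is \<open>Y\<^sup>2 + a1 X Y - (3 x + a2) X\<^sup>2 = (Y - \<alpha> X) (Y - \<beta> X)\<close>; the point is a
  cusp if the two tangent slopes coincide and a node otherwise. A double root of a monic quadratic
  polynomial over \<open>F\<^sub>p\<close> lies in \<open>F\<^sub>p\<close>.\<close>

definition cusp_mod :: "nat \<Rightarrow> int weierstrass \<Rightarrow> int \<Rightarrow> int \<Rightarrow> bool" where
  "cusp_mod p M x y \<longleftrightarrow> singular_point_mod p M x y \<and>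
     (\<exists>\<alpha>. [a1 M = - 2 * \<alpha>] (mod int p) \<and> [- (3 * x + a2 M) = \<alpha> ^ 2] (mod int p))"

definition node_mod :: "nat \<Rightarrow> int weierstrass \<Rightarrow> int \<Rightarrow> int \<Rightarrow> bool" where
  "node_mod p M x y \<longleftrightarrow> singular_point_mod p M x y \<and> \<not> cusp_mod p M x y"

definition good_reduction :: "rat weierstrass \<Rightarrow> nat \<Rightarrow> bool" where
  "good_reduction E p \<longleftrightarrow>
     (\<exists>M. minimal_model_at p E M \<and> (\<nexists>x y. singular_point_mod p M x y))"

definition multiplicative_reduction :: "rat weierstrass \<Rightarrow> nat \<Rightarrow> bool" where
  "multiplicative_reduction E p \<longleftrightarrow>
     (\<exists>M. minimal_model_at p E M \<and> (\<exists>x y. node_mod p M x y))"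

definition additive_reduction :: "rat weierstrass \<Rightarrow> nat \<Rightarrow> bool" where
  "additive_reduction E p \<longleftrightarrow>
     (\<exists>M. minimal_model_at p E M \<and> (\<exists>x y. cusp_mod p M x y))"

definition semistable :: "rat weierstrass \<Rightarrow> bool" where
  "semistable E \<longleftrightarrow> (\<forall>p. prime p \<longrightarrow> \<not> additive_reduction E p)"


section \<open>Torsion points\<close>

text \<open>\<open>None\<close> is the point at infinity.\<close>

type_synonym 'a point = "('a \<times> 'a) option"

definition points :: "'a::field weierstrass \<Rightarrow> 'a point set" where
  "points W = insert None (Some ` {(x, y). weierstrass_poly W x y = 0})"

fun point_add :: "'a::field weierstrass \<Rightarrow> 'a point \<Rightarrow> 'a point \<Rightarrow> 'a point" where
  "point_add W None Q = Q"
| "point_add W P None = P"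
| "point_add W (Some (x1, y1)) (Some (x2, y2)) =
     (if x1 = x2 \<and> y1 + y2 + a1 W * x2 + a3 W = 0 then None
      else
        let m = (if x1 = x2
                 then (3 * x1 ^ 2 + 2 * a2 W * x1 + a4 W - a1 W * y1) / (2 * y1 + a1 W * x1 + a3 W)
                 else (y2 - y1) / (x2 - x1));
            x3 = m ^ 2 + a1 W * m - a2 W - x1 - x2
        in Some (x3, - (m + a1 W) * x3 - (y1 - m * x1) - a3 W))"

definition torsion_points :: "rat weierstrass \<Rightarrow> nat \<Rightarrow> complex point set" where
  "torsion_points E n =
     (let W = map_weierstrass of_rat E
      in {P \<in> points W. (point_add W P ^^ n) None = None})"


section \<open>Ramification groups\<close>

abbreviation complex_ring :: "complex ring" where
  "complex_ring \<equiv> ring_of_type_algebra"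

definition torsion_field :: "rat weierstrass \<Rightarrow> nat \<Rightarrow> complex set" where
  "torsion_field E n =
     generate_field complex_ring (\<Union>{{x, y} | x y. Some (x, y) \<in> torsion_points E n})"

definition integers_of :: "complex set \<Rightarrow> complex ring" where
  "integers_of K = complex_ring\<lparr>carrier := {x \<in> K. algebraic_int x}\<rparr>"

text \<open>Automorphisms are made extensional, so that they are determined by their values on \<open>K\<close>.\<close>

definition automorphisms :: "complex set \<Rightarrow> (complex \<Rightarrow> complex) set" where
  "automorphisms K =
     ring_iso (complex_ring\<lparr>carrier := K\<rparr>) (complex_ring\<lparr>carrier := K\<rparr>) \<inter> extensional K"

definition prime_above :: "complex set \<Rightarrow> nat \<Rightarrow> complex set \<Rightarrow> bool" where
  "prime_above K p \<pp> \<longleftrightarrow> primeideal \<pp> (integers_of K) \<and> of_nat p \<in> \<pp>"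

definition ideal_power :: "complex set \<Rightarrow> complex set \<Rightarrow> nat \<Rightarrow> complex set" where
  "ideal_power K \<pp> n =
     (ideal_prod (integers_of K) \<pp> ^^ n) (carrier (integers_of K))"

text \<open>Lower numbering. For \<open>K\<close> Galois over the rationals, restriction identifies these groups with
  the ramification groups of the completion of \<open>K\<close> at \<open>\<pp>\<close> over the \<open>p\<close>-adic numbers.\<close>

definition ramification_group :: "complex set \<Rightarrow> complex set \<Rightarrow> nat \<Rightarrow> (complex \<Rightarrow> complex) set" where
  "ramification_group K \<pp> i =
     {\<sigma> \<in> automorphisms K.
        \<forall>x \<in> carrier (integers_of K). \<sigma> x - x \<in> ideal_power K \<pp> (i + 1)}"

definition fixed_points :: "(complex \<Rightarrow> complex) set \<Rightarrow> complex point set \<Rightarrow> complex point set" where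
  "fixed_points G T = {P \<in> T. \<forall>\<sigma> \<in> G. map_option (map_prod \<sigma> \<sigma>) P = P}"


section \<open>The conductor\<close>

text \<open>The wild part of the exponent of the conductor is
  \[ \delta = \sum_{i \ge 1} \frac{|G_i|}{|G_0|} \dim_{F_l} (E[l] / E[l]^{G_i}), \]
  where \<open>G\<^sub>i\<close> are the ramification groups of \<open>K = Q(E[l])\<close> at a prime \<open>\<pp>\<close> above \<open>p\<close>. It is an
  integer that depends neither on the prime \<open>l \<noteq> p\<close> nor on \<open>\<pp>\<close>; only finitely many terms are
  nonzero.\<close>

definition wild_exponent :: "rat weierstrass \<Rightarrow> nat \<Rightarrow> nat" where
  "wild_exponent E p =
     (let l = (if p = 2 then 3 else 2);
          T = torsion_points E l;
          K = torsion_field E l;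
          G = ramification_group K (SOME \<pp>. prime_above K p \<pp>)
      in nat \<lfloor>\<Sum>i. real (card (G (Suc i))) / real (card (G 0)) *
                 log (real l) (real (card T) / real (card (fixed_points (G (Suc i)) T)))\<rfloor>)"

definition conductor_exponent :: "rat weierstrass \<Rightarrow> nat \<Rightarrow> nat" where
  "conductor_exponent E p =
     (if good_reduction E p then 0
      else if multiplicative_reduction E p then 1
      else 2 + wild_exponent E p)"

definition conductor :: "rat weierstrass \<Rightarrow> nat" where
  "conductor E = (\<Prod>p | prime p \<and> \<not> good_reduction E p. p ^ conductor_exponent E p)"

text \<open>The choice of global minimal model is immaterial: \<open>c4\<close> and \<open>c6\<close> are the same for all of them.\<close>

definition good_elliptic_curve :: "rat weierstrass \<Rightarrow> bool" where
  "good_elliptic_curve E \<longleftrightarrow>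
     (\<exists>M. global_minimal_model E M \<and> int (conductor E) ^ 6 < max \<bar>c4 M ^ 3\<bar> (c6 M ^ 2))"

end

theory Submission
  imports Defs
begin

text \<open>For a global minimal model, bad reduction at \<open>p\<close> means \<open>p dvd \<Delta>\<close>, and a singular point modulo
  \<open>p\<close> is a cusp if moreover \<open>p dvd c4\<close>. So semistability makes \<open>\<Delta>\<close> and \<open>c4\<close> coprime and makes
  the conductor \<open>N\<close> equal to \<open>rad \<Delta>\<close>; no wild ramification enters. As \<open>6 dvd \<Delta>\<close>, the factor
  \<open>1728\<close> contributes no new primes, and for \<open>m = max \<bar>c4\<^sup>3\<bar> c6\<^sup>2\<close> the radical of the product is
  at most \<open>N \<cdot> \<bar>c4\<bar> \<cdot> \<bar>c6\<bar>\<close>, which is less than \<open>m\<close> since the three factors are bounded by the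
  sixth, third and second roots of \<open>m\<close>, the first one strictly.\<close>

section \<open>Change of coordinates\<close>

text \<open>The substitution of \<^const>\<open>isomorphic\<close> with \<open>u = 1\<close>.\<close>

definition translate :: "'a \<Rightarrow> 'a \<Rightarrow> 'a \<Rightarrow> 'a::comm_ring_1 weierstrass \<Rightarrow> 'a weierstrass" where
  "translate r s t W = Weierstrass
     (a1 W + 2 * s)
     (a2 W - s * a1 W + 3 * r - s ^ 2)
     (a3 W + r * a1 W + 2 * t)
     (a4 W - s * a3 W + 2 * r * a2 W - (t + r * s) * a1 W + 3 * r ^ 2 - 2 * s * t)
     (a6 W + r * a4 W + r ^ 2 * a2 W + r ^ 3 - t * a3 W - t ^ 2 - r * t * a1 W)"

lemma translate_sel [simp]:
  "a1 (translate r s t W) = a1 W + 2 * s"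
  "a2 (translate r s t W) = a2 W - s * a1 W + 3 * r - s ^ 2"
  "a3 (translate r s t W) = a3 W + r * a1 W + 2 * t"
  "a4 (translate r s t W) =
     a4 W - s * a3 W + 2 * r * a2 W - (t + r * s) * a1 W + 3 * r ^ 2 - 2 * s * t"
  "a6 (translate r s t W) =
     a6 W + r * a4 W + r ^ 2 * a2 W + r ^ 3 - t * a3 W - t ^ 2 - r * t * a1 W"
  by (simp_all add: translate_def)

lemma b2_translate:
  fixes W :: "'a::idom weierstrass"
  shows "b2 (translate r s t W) = b2 W + 12 * r"
  unfolding b2_def translate_sel by Groebner_Basis.algebra

lemma b4_translate:
  fixes W :: "'a::idom weierstrass"
  shows "b4 (translate r s t W) = b4 W + r * b2 W + 6 * r ^ 2"
  unfolding b2_def b4_def translate_sel by Groebner_Basis.algebra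

lemma b6_translate:
  fixes W :: "'a::idom weierstrass"
  shows "b6 (translate r s t W) = b6 W + 2 * r * b4 W + r ^ 2 * b2 W + 4 * r ^ 3"
  unfolding b2_def b4_def b6_def translate_sel by Groebner_Basis.algebra

lemma b8_translate:
  fixes W :: "'a::idom weierstrass"
  shows "b8 (translate r s t W) = b8 W + 3 * r * b6 W + 3 * r ^ 2 * b4 W + r ^ 3 * b2 W + 3 * r ^ 4"
  unfolding b2_def b4_def b6_def b8_def translate_sel by Groebner_Basis.algebra

text \<open>The translation invariance of the discriminant and its expression through
  \<open>c4\<close> and \<open>c6\<close> are identities in the b-invariants only modulo this
  relation.\<close>

lemma b8_relation:
  fixes W :: "'a::idom weierstrass"
  shows "4 * b8 W = b2 W * b6 W - b4 W ^ 2"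
  unfolding b2_def b4_def b6_def b8_def by Groebner_Basis.algebra

lemma c4_translate:
  fixes W :: "'a::idom weierstrass"
  shows "c4 (translate r s t W) = c4 W"
  unfolding c4_def b2_translate b4_translate by Groebner_Basis.algebra

lemma c6_translate:
  fixes W :: "'a::idom weierstrass"
  shows "c6 (translate r s t W) = c6 W"
  unfolding c6_def b2_translate b4_translate b6_translate by Groebner_Basis.algebra

lemma discriminant_translate:
  fixes W :: "'a::idom weierstrass"
  shows "discriminant (translate r s t W) = discriminant W"
  unfolding discriminant_def b2_translate b4_translate b6_translate b8_translate
  using b8_relation[of W] by Groebner_Basis.algebra

lemma discriminant_c4_c6:
  fixes W :: "'a::idom weierstrass"
  shows "1728 * discriminant W = c4 W ^ 3 - c6 W ^ 2"
  unfolding discriminant_def c4_def c6_def using b8_relation[of W] by Groebner_Basis.algebra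

text \<open>The substitution is a translation, which fixes the invariants, combined with a scaling,
  which contributes \<open>u\<close> to the power of the weight.\<close>

lemma isomorphic_invariants:
  fixes W W' :: "'a::field weierstrass"
  assumes "isomorphic W W'"
  obtains u where "u \<noteq> 0" "u ^ 4 * c4 W' = c4 W" "u ^ 6 * c6 W' = c6 W"
    "u ^ 12 * discriminant W' = discriminant W"
proof -
  from assms obtain u r s t where "u \<noteq> 0"
    and eq: "a1 (translate r s t W) = u * a1 W'" "a2 (translate r s t W) = u ^ 2 * a2 W'"
      "a3 (translate r s t W) = u ^ 3 * a3 W'" "a4 (translate r s t W) = u ^ 4 * a4 W'"
      "a6 (translate r s t W) = u ^ 6 * a6 W'"
    unfolding isomorphic_def translate_sel by metis
  have b: "b2 (translate r s t W) = u ^ 2 * b2 W'" "b4 (translate r s t W) = u ^ 4 * b4 W'"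
      "b6 (translate r s t W) = u ^ 6 * b6 W'" "b8 (translate r s t W) = u ^ 8 * b8 W'"
    unfolding b2_def b4_def b6_def b8_def eq by Groebner_Basis.algebra+
  have "u ^ 4 * c4 W' = c4 (translate r s t W)" "u ^ 6 * c6 W' = c6 (translate r s t W)"
    "u ^ 12 * discriminant W' = discriminant (translate r s t W)"
    unfolding c4_def c6_def discriminant_def b by Groebner_Basis.algebra+
  with \<open>u \<noteq> 0\<close> show thesis
    using that c4_translate c6_translate discriminant_translate by metis
qed

lemma map_weierstrass_of_int [simp]:
  "c4 (map_weierstrass of_int M) = of_int (c4 M)"
  "c6 (map_weierstrass of_int M) = of_int (c6 M)"
  "discriminant (map_weierstrass of_int M) = of_int (discriminant M)"
  by (simp_all add: c4_def c6_def discriminant_def b2_def b4_def b6_def b8_def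
      weierstrass.map_sel)


section \<open>Uniqueness of the minimal invariants\<close>

lemma abs_eq_if_multiplicity_eq:
  fixes a b :: int
  assumes "a \<noteq> 0" "b \<noteq> 0"
    and "\<And>p::nat. prime p \<Longrightarrow> multiplicity (int p) a = multiplicity (int p) b"
  shows "\<bar>a\<bar> = \<bar>b\<bar>"
proof -
  have "multiplicity p a = multiplicity p b" if "prime p" for p
    using assms(3)[of "nat p"] that by (simp add: prime_ge_0_int)
  then have "normalize a = normalize b"
    using assms by (intro multiplicity_eq_imp_eq) auto
  then show ?thesis by simp
qed

lemma integral_model_discriminant_nonzero:
  assumes "elliptic_curve E" "integral_model E M"
  shows "discriminant M \<noteq> 0"
proof
  assume "discriminant M = 0"
  obtain u :: rat where "u ^ 12 * discriminant (map_weierstrass of_int M) = discriminant E"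
    using assms(2) isomorphic_invariants unfolding integral_model_def by blast
  with \<open>discriminant M = 0\<close> assms(1) show False by (simp add: elliptic_curve_def)
qed

text \<open>Minimality at every prime fixes the absolute value of the discriminant, so the scalings
  \<open>u\<close> and \<open>v\<close> from \<open>E\<close> satisfy \<open>u^12 = v^12\<close>.
  The weights 4, 6 and 12 are even, so \<open>u^2 = v^2\<close> is enough.\<close>

lemma global_minimal_model_unique:
  assumes ell: "elliptic_curve E" and M: "global_minimal_model E M"
    and M': "global_minimal_model E M'"
  shows "discriminant M = discriminant M'" "c4 M = c4 M'" "c6 M = c6 M'"
proof -
  have int: "integral_model E M" "integral_model E M'"
    using M M' by (auto simp: global_minimal_model_def)
  have nz: "discriminant M \<noteq> 0" "discriminant M' \<noteq> 0"
    using integral_model_discriminant_nonzero ell int by auto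
  have abs: "\<bar>discriminant M\<bar> = \<bar>discriminant M'\<bar>"
  proof (rule abs_eq_if_multiplicity_eq[OF nz])
    fix p :: nat assume "prime p"
    then show "multiplicity (int p) (discriminant M) = multiplicity (int p) (discriminant M')"
      using M M' int by (intro antisym) (auto simp: global_minimal_model_def minimal_model_at_def)
  qed
  obtain u :: rat where u: "u \<noteq> 0" "u ^ 4 * of_int (c4 M) = c4 E" "u ^ 6 * of_int (c6 M) = c6 E"
    "u ^ 12 * of_int (discriminant M) = discriminant E"
    using isomorphic_invariants[of E "map_weierstrass of_int M"] int
    by (auto simp: integral_model_def)
  obtain v :: rat where v: "v \<noteq> 0" "v ^ 4 * of_int (c4 M') = c4 E" "v ^ 6 * of_int (c6 M') = c6 E"
    "v ^ 12 * of_int (discriminant M') = discriminant E"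
    using isomorphic_invariants[of E "map_weierstrass of_int M'"] int
    by (auto simp: integral_model_def)
  have "\<bar>u ^ 12 * of_int (discriminant M)\<bar> = \<bar>v ^ 12 * of_int (discriminant M')\<bar>"
    using u v by simp
  then have "u ^ 12 * of_int \<bar>discriminant M\<bar> = v ^ 12 * of_int \<bar>discriminant M'\<bar>"
    by (simp add: abs_mult power_abs)
  then have "u ^ 12 = v ^ 12"
    using abs nz by simp
  \<comment> \<open>Rational squares are nonnegative, where taking sixth powers is
    injective.\<close>
  then have "(u ^ 2) ^ 6 = (v ^ 2) ^ 6" by (simp flip: power_mult)
  then have uv: "u ^ 2 = v ^ 2"
    by (rule power_eq_imp_eq_base) auto
  have "u ^ 4 = (u ^ 2) ^ 2" "v ^ 4 = (v ^ 2) ^ 2" "u ^ 6 = (u ^ 2) ^ 3" "v ^ 6 = (v ^ 2) ^ 3"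
    by (simp_all flip: power_mult)
  then have "u ^ 4 = v ^ 4" "u ^ 6 = v ^ 6" using uv by metis+
  moreover have "u ^ 12 * of_int (discriminant M) = v ^ 12 * of_int (discriminant M')"
    "u ^ 4 * of_int (c4 M) = v ^ 4 * of_int (c4 M')"
    "u ^ 6 * of_int (c6 M) = v ^ 6 * of_int (c6 M')"
    by (simp_all only: u v)
  ultimately have "v ^ 12 * of_int (discriminant M) = v ^ 12 * of_int (discriminant M')"
    "v ^ 4 * of_int (c4 M) = v ^ 4 * of_int (c4 M')"
    "v ^ 6 * of_int (c6 M) = v ^ 6 * of_int (c6 M')"
    by (simp_all only: \<open>u ^ 12 = v ^ 12\<close>)
  then show "discriminant M = discriminant M'" "c4 M = c4 M'" "c6 M = c6 M'"
    using v(1) by simp_all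
qed

lemma minimal_discriminant_eq:
  assumes "elliptic_curve E" "global_minimal_model E M"
  shows "minimal_discriminant E = discriminant M"
  unfolding minimal_discriminant_def
proof (rule the_equality)
  show "\<exists>M'. global_minimal_model E M' \<and> discriminant M = discriminant M'"
    using assms(2) by blast
  show "D = discriminant M" if "\<exists>M'. global_minimal_model E M' \<and> D = discriminant M'" for D
    using that global_minimal_model_unique(1)[OF assms(1) _ assms(2)] by blast
qed


section \<open>Singular points modulo a prime\<close>

text \<open>Once the point is moved to the origin, the constant and linear terms of the equation are
  its value and partial derivatives there.\<close>

lemma translate_singular_point:
  "a3 (translate x 0 y W) = weierstrass_poly_dy W x y"
  "a4 (translate x 0 y W) = - weierstrass_poly_dx W x y"
  "a6 (translate x 0 y W) = - weierstrass_poly W x y"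
  by (simp_all add: weierstrass_poly_def weierstrass_poly_dx_def weierstrass_poly_dy_def algebra_simps)

lemma singular_point_mod_iff:
  "singular_point_mod p M x y \<longleftrightarrow>
     int p dvd a3 (translate x 0 y M) \<and> int p dvd a4 (translate x 0 y M) \<and>
     int p dvd a6 (translate x 0 y M)"
  unfolding singular_point_mod_def translate_singular_point cong_0_iff by auto

text \<open>With the singular point at the origin, \<open>b4\<close>, \<open>b6\<close> and
  \<open>b8\<close> vanish modulo \<open>p\<close>, and every term of the discriminant contains one
  of them.\<close>

lemma singular_point_mod_dvd_discriminant:
  assumes "singular_point_mod p M x y"
  shows "int p dvd discriminant M"
proof -
  define V where "V = translate x 0 y M"
  have "int p dvd a3 V" "int p dvd a4 V" "int p dvd a6 V"
    using assms by (simp_all add: V_def singular_point_mod_iff)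
  then have "int p dvd b4 V" "int p dvd b6 V" "int p dvd b8 V"
    by (simp_all add: b4_def b6_def b8_def power2_eq_square)
  then have "int p dvd discriminant V"
    by (simp add: discriminant_def power2_eq_square power3_eq_cube)
  then show ?thesis by (simp add: V_def discriminant_translate)
qed

text \<open>With the point at the origin, \<open>b4\<close> vanishes modulo \<open>p\<close>, so
  \<open>c4\<close> reduces to \<open>b2^2\<close>, and \<open>b2\<close> is the discriminant of the
  quadratic for the tangent slopes.\<close>

lemma singular_point_mod_is_cusp:
  assumes p: "prime p" and sing: "singular_point_mod p M x y" and c4: "int p dvd c4 M"
  shows "cusp_mod p M x y"
proof -
  define V where "V = translate x 0 y M"
  have pp: "prime (int p)" using p by simp
  have "int p dvd a3 V" "int p dvd a4 V"
    using sing by (simp_all add: V_def singular_point_mod_iff)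
  then have "int p dvd b4 V" by (simp add: b4_def)
  moreover have "b2 V ^ 2 = c4 M + 24 * b4 V"
    using c4_translate[of x 0 y M] by (simp add: V_def c4_def)
  ultimately have "int p dvd b2 V ^ 2" using c4 by simp
  then have "int p dvd b2 V" using pp prime_dvd_power by blast
  then have b2: "int p dvd a1 M ^ 2 + 4 * (a2 M + 3 * x)"
    by (simp add: V_def b2_def)
  have "\<exists>\<alpha>. [a1 M = - 2 * \<alpha>] (mod int p) \<and> [- (3 * x + a2 M) = \<alpha> ^ 2] (mod int p)"
  proof (cases "p = 2")
    case True
    then have "even (a1 M)" using b2 by simp
    then show ?thesis
      \<comment> \<open>Modulo 2 signs disappear and each residue is its own square root.\<close>
      using True by (intro exI[of _ "3 * x + a2 M"]) (auto simp: cong_iff_dvd_diff)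
  next
    case False
    then have odd: "odd (int p)" using p by (simp add: prime_odd_nat prime_ge_2_nat order_less_le)
    \<comment> \<open>The double root is \<open>- a1 / 2\<close> modulo \<open>p\<close>: halve
      whichever of \<open>- a1\<close> and \<open>p - a1\<close> is even.\<close>
    obtain \<alpha> where "int p dvd a1 M + 2 * \<alpha>"
    proof (cases "even (a1 M)")
      case True
      then show ?thesis using that[of "- (a1 M div 2)"] by simp
    next
      case False
      then have "2 * ((int p - a1 M) div 2) = int p - a1 M" using odd by simp
      then show ?thesis using that[of "(int p - a1 M) div 2"] by simp
    qed
    then obtain k where k: "a1 M + 2 * \<alpha> = int p * k" by (elim dvdE)
    have "2 ^ 2 * (- (3 * x + a2 M) - \<alpha> ^ 2) =
        (a1 M + 2 * \<alpha>) * (a1 M - 2 * \<alpha>) - (a1 M ^ 2 + 4 * (a2 M + 3 * x))"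
      by Groebner_Basis.algebra
    then have "int p dvd 2 ^ 2 * (- (3 * x + a2 M) - \<alpha> ^ 2)"
      unfolding k using b2 by (metis dvd_diff dvd_triv_left dvd_mult2)
    moreover have "coprime (int p) (2 ^ 2)" using odd
      by (simp only: coprime_power_right_iff coprime_right_2_iff_odd simp_thms)
    ultimately have "int p dvd - (3 * x + a2 M) - \<alpha> ^ 2"
      using coprime_dvd_mult_right_iff by blast
    then show ?thesis using k by (intro exI[of _ \<alpha>]) (auto simp: cong_iff_dvd_diff)
  qed
  with sing show ?thesis by (simp add: cusp_mod_def)
qed

text \<open>Every residue modulo 2 is its own square, so the singular point has coordinates
  polynomial in the coefficients.\<close>

lemma singular_point_mod_2:
  assumes "2 dvd discriminant M"
  shows "\<exists>x y. singular_point_mod 2 M x y"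
proof (cases "even (a1 M)")
  case True
  \<comment> \<open>Here \<open>b2\<close> and \<open>b4\<close> are even, so the discriminant is
    congruent to \<open>a3\<close>.\<close>
  have "even (a3 M)"
    using assms True by (simp add: discriminant_def b2_def b4_def b6_def b8_def)
  \<comment> \<open>The x-derivative reduces to \<open>x^2 + a4\<close>, giving
    \<open>x = a4\<close>; then \<open>y = y^2\<close> is the value of the cubic at
    \<open>x\<close>.\<close>
  then have "singular_point_mod 2 M (a4 M) (a4 M ^ 3 + a2 M * a4 M ^ 2 + a4 M * a4 M + a6 M)"
    using True by (auto simp: singular_point_mod_def cong_0_iff weierstrass_poly_def
        weierstrass_poly_dx_def weierstrass_poly_dy_def)
  then show ?thesis by blast
next
  case False
  \<comment> \<open>The y-derivative forces \<open>x = a3\<close>, then the x-derivative forces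
    \<open>y = x^2 + a4\<close>. At this point the equation of the curve reduces to the
    discriminant.\<close>
  have "singular_point_mod 2 M (a3 M) (a3 M + a4 M)"
    using assms False by (auto simp: singular_point_mod_def cong_0_iff weierstrass_poly_def
        weierstrass_poly_dx_def weierstrass_poly_dy_def
        discriminant_def b2_def b4_def b6_def b8_def)
  then show ?thesis by blast
qed

text \<open>Completing the square reduces the search to a multiple root \<open>x\<close> of
  \<open>4 x\<^sup>3 + b2 x\<^sup>2 + 2 b4 x + b6\<close>.\<close>

lemma singular_point_mod_if_double_root:
  assumes odd: "odd p"
    and root: "int p dvd 4 * x ^ 3 + b2 M * x ^ 2 + 2 * b4 M * x + b6 M"
    and deriv: "int p dvd 6 * x ^ 2 + b2 M * x + b4 M"
  shows "\<exists>y. singular_point_mod p M x y"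
proof -
  have cop: "coprime (int p) 2" "coprime (int p) (2 ^ 2)"
    using odd
    by (simp_all only: coprime_power_right_iff coprime_right_2_iff_odd even_of_nat simp_thms)
  obtain y where y: "int p dvd 2 * y + a1 M * x + a3 M"
  proof (cases "even (a1 M * x + a3 M)")
    case True
    then have "2 * ((a1 M * x + a3 M) div 2) = a1 M * x + a3 M"
      by (rule dvd_mult_div_cancel)
    then show ?thesis using that[of "- ((a1 M * x + a3 M) div 2)"] by (simp add: add.assoc)
  next
    case False
    then have "even (int p - (a1 M * x + a3 M))" using odd by simp
    then have "2 * ((int p - (a1 M * x + a3 M)) div 2) = int p - (a1 M * x + a3 M)"
      by (rule dvd_mult_div_cancel)
    then show ?thesis
      using that[of "(int p - (a1 M * x + a3 M)) div 2"] by (simp add: add.assoc)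
  qed
  have "2 ^ 2 * weierstrass_poly M x y = (2 * y + a1 M * x + a3 M) ^ 2 -
      (4 * x ^ 3 + b2 M * x ^ 2 + 2 * b4 M * x + b6 M)"
    unfolding weierstrass_poly_def b2_def b4_def b6_def by Groebner_Basis.algebra
  then have "int p dvd 2 ^ 2 * weierstrass_poly M x y"
    using y root by (simp add: power2_eq_square)
  then have 1: "int p dvd weierstrass_poly M x y"
    using cop coprime_dvd_mult_right_iff by blast
  \<comment> \<open>The last bracket is half the derivative of the cubic.\<close>
  have "2 * weierstrass_poly_dx M x y =
      a1 M * (2 * y + a1 M * x + a3 M) - (6 * x ^ 2 + b2 M * x + b4 M)"
    unfolding weierstrass_poly_dx_def b2_def b4_def by Groebner_Basis.algebra
  then have "int p dvd 2 * weierstrass_poly_dx M x y"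
    using y deriv by simp
  then have 2: "int p dvd weierstrass_poly_dx M x y"
    using cop coprime_dvd_mult_right_iff by blast
  have 3: "int p dvd weierstrass_poly_dy M x y"
    using y by (simp add: weierstrass_poly_dy_def)
  show ?thesis using 1 2 3 by (auto simp: singular_point_mod_def cong_0_iff)
qed

text \<open>Modulo \<open>3\<close> the derivative is \<open>2 (b2 x + b4)\<close>, with root \<open>- b2 b4\<close> as \<open>b2\<^sup>2 = 1\<close>; if \<open>b2\<close>
  vanishes, so does \<open>b4\<close>, and \<open>x\<^sup>3 + b6\<close> has the triple root \<open>- b6\<close>.\<close>

lemma singular_point_mod_3:
  assumes disc: "3 dvd discriminant M"
  shows "\<exists>x y. singular_point_mod 3 M x y"
proof -
  have fermat: "3 dvd n ^ 3 - n" "3 dvd n \<or> 3 dvd n ^ 2 - 1" for n :: int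
  proof -
    have "n mod 3 = 0 \<or> n mod 3 = 1 \<or> n mod 3 = 2" by presburger
    then have "3 dvd n \<or> 3 dvd n - 1 \<or> 3 dvd n + 1" by presburger
    moreover have "n ^ 3 - n = n * ((n - 1) * (n + 1))" "n ^ 2 - 1 = (n - 1) * (n + 1)"
      by Groebner_Basis.algebra+
    ultimately show "3 dvd n ^ 3 - n" "3 dvd n \<or> 3 dvd n ^ 2 - 1" by auto
  qed
  obtain x where "3 dvd 4 * x ^ 3 + b2 M * x ^ 2 + 2 * b4 M * x + b6 M"
    "3 dvd 6 * x ^ 2 + b2 M * x + b4 M"
  proof (cases "3 dvd b2 M")
    case True
    have "8 * b4 M ^ 3 = - (b2 M ^ 2 * b8 M) - 27 * b6 M ^ 2 + 9 * b2 M * b4 M * b6 M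
        - discriminant M"
      unfolding discriminant_def by Groebner_Basis.algebra
    moreover have "3 dvd \<dots>" using True disc by (simp add: power2_eq_square)
    ultimately have "3 dvd 8 * b4 M ^ 3" by simp
    then have b4: "3 dvd b4 M" using fermat(1)[of "b4 M"] by presburger
    have "4 * (- b6 M) ^ 3 + b2 M * (- b6 M) ^ 2 + 2 * b4 M * (- b6 M) + b6 M =
        b2 M * b6 M ^ 2 - b4 M * (2 * b6 M) - 3 * b6 M ^ 3 - (b6 M ^ 3 - b6 M)"
      by Groebner_Basis.algebra
    also have "3 dvd \<dots>"
      using fermat(1)[of "b6 M"] True b4 by (intro dvd_diff[OF dvd_diff[OF dvd_diff]]) simp_all
    finally show ?thesis
      by (rule that) (use True b4 in simp)
  next
    case False
    then obtain k where "b2 M ^ 2 - 1 = 3 * k" using fermat(2)[of "b2 M"] by (auto elim: dvdE)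
    then have k: "b2 M ^ 2 = 1 + 3 * k" by simp
    obtain m where "b4 M ^ 3 - b4 M = 3 * m" using fermat(1)[of "b4 M"] by (auto elim: dvdE)
    then have m: "b4 M ^ 3 = b4 M + 3 * m" by simp
    \<comment> \<open>The factor 4, which is 1 modulo 3, allows \<open>b8\<close> to be
      eliminated.\<close>
    have four: "4 * discriminant M = - (b2 M ^ 2 * (b2 M * b6 M - b4 M ^ 2))
        - 32 * b4 M ^ 3 - 108 * b6 M ^ 2 + 36 * b2 M * b4 M * b6 M"
      unfolding discriminant_def using b8_relation[of M] by Groebner_Basis.algebra
    let ?x = "- (b2 M * b4 M)"
    \<comment> \<open>Modulo 3 the cubic takes the value \<open>- b2\<close> times the discriminant
      at \<open>?x\<close>; \<open>k\<close> and \<open>m\<close> record the errors in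
      \<open>b2^2 = 1\<close> and \<open>b4^3 = b4\<close>.\<close>
    have "4 * ?x ^ 3 + b2 M * ?x ^ 2 + 2 * b4 M * ?x + b6 M =
        3 * (- 12 * b2 M * b4 M - 36 * b2 M * m - 4 * k * b2 M * (b4 M + 3 * m)
          + 2 * k * b2 M * b4 M ^ 2 - (2 * k + 3 * k ^ 2) * b6 M - 36 * b2 M * b6 M ^ 2
          + 12 * b2 M ^ 2 * b4 M * b6 M) - b2 M * (4 * discriminant M)"
      using k m four by Groebner_Basis.algebra
    also have "3 dvd \<dots>" using disc by (intro dvd_diff) auto
    finally have "3 dvd 4 * ?x ^ 3 + b2 M * ?x ^ 2 + 2 * b4 M * ?x + b6 M" .
    moreover have "6 * ?x ^ 2 + b2 M * ?x + b4 M = 3 * (2 * ?x ^ 2 - k * b4 M)"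
      using k by Groebner_Basis.algebra
    ultimately show ?thesis using that[of ?x] by (metis dvd_triv_left)
  qed
  then show ?thesis using singular_point_mod_if_double_root[of 3 x M] by auto
qed

text \<open>With \<open>T = 12 x + b2\<close> the cubic becomes \<open>T\<^sup>3 - 3 c4 T - 2 c6\<close> up to the factor \<open>432\<close>, and its
  double root is \<open>T = - c6 / c4\<close>, or \<open>T = 0\<close> if \<open>c4\<close> vanishes.\<close>

lemma singular_point_mod_ge_5:
  assumes p: "prime p" "p \<noteq> 2" "p \<noteq> 3" and disc: "int p dvd discriminant M"
  shows "\<exists>x y. singular_point_mod p M x y"
proof -
  have pp: "prime (int p)" using p by simp
  have nd: "\<not> int p dvd 2" "\<not> int p dvd 3"
    using p prime_ge_2_nat[OF p(1)] by (auto dest!: zdvd_imp_le)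
  have odd: "odd p" using p by (simp add: prime_odd_nat prime_ge_2_nat order_less_le)
  have ndpow: "\<not> int p dvd 2 ^ i * 3 ^ j" for i j
    using nd pp prime_dvd_power by (metis prime_dvd_mult_iff)
  have c: "int p dvd c4 M ^ 3 - c6 M ^ 2"
    using disc discriminant_c4_c6[of M] by (metis dvd_mult)
  \<comment> \<open>These are the conditions for a double root: the derivative is
    \<open>3 * (T^2 - c4)\<close> and the cubic is
    \<open>T * (T^2 - c4) - 2 * (c4 * T + c6)\<close>.\<close>
  obtain T where T: "int p dvd T ^ 2 - c4 M" "int p dvd c4 M * T + c6 M"
  proof (cases "int p dvd c4 M")
    case True
    then have "int p dvd c4 M ^ 3" by (simp add: power3_eq_cube)
    with c have "int p dvd c6 M ^ 2" by (metis dvd_diff_right_iff dvd_diff_commute)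
    then have "int p dvd c6 M" using pp prime_dvd_power by blast
    with True show ?thesis using that[of 0] by simp
  next
    case False
    then have "coprime (c4 M) (int p)"
      using pp prime_imp_coprime coprime_commute by blast
    then obtain j where "[c4 M * j = 1] (mod int p)" using cong_solve_coprime_int by blast
    then obtain k where k: "c4 M * j = 1 + int p * k"
      by (metis cong_iff_lin cong_sym)
    define T where "T = - c6 M * j"
    have T2: "c4 M * T + c6 M = int p * (- c6 M * k)"
      using k unfolding T_def by Groebner_Basis.algebra
    \<comment> \<open>Substituting \<open>c4 * T = - c6\<close> modulo \<open>p\<close> leaves
      \<open>c6^2 - c4^3\<close>, a multiple of the discriminant.\<close>
    have "c4 M ^ 2 * (T ^ 2 - c4 M) = (c4 M * T + c6 M) * (c4 M * T - c6 M) - (c4 M ^ 3 - c6 M ^ 2)"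
      by Groebner_Basis.algebra
    then have "int p dvd c4 M ^ 2 * (T ^ 2 - c4 M)" using c T2 by simp
    moreover have "\<not> int p dvd c4 M ^ 2" using False pp prime_dvd_power by blast
    ultimately have "int p dvd T ^ 2 - c4 M" using pp prime_dvd_mult_iff by blast
    with T2 show ?thesis using that[of T] by simp
  qed
  have "coprime 12 (int p)"
    using ndpow[of 2 1] pp prime_imp_coprime[of "int p" 12] by (simp add: coprime_commute)
  then obtain i where "[12 * i = 1] (mod int p)" using cong_solve_coprime_int by blast
  then obtain k where k: "12 * i = 1 + int p * k" by (metis cong_iff_lin cong_sym)
  \<comment> \<open>This is \<open>(T - b2) / 12\<close> modulo \<open>p\<close>; \<open>e\<close>
    measures the deviation of \<open>12 * x + b2\<close> from \<open>T\<close>.\<close>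
  define x where "x = i * (T - b2 M)"
  define e where "e = k * (T - b2 M)"
  have x: "12 * x + b2 M = T + int p * e"
    using k unfolding x_def e_def by Groebner_Basis.algebra
  have "(12 * x + b2 M) ^ 2 - c4 M = (T ^ 2 - c4 M) + int p * (2 * T * e + int p * e ^ 2)"
    unfolding x by Groebner_Basis.algebra
  then have X1: "int p dvd (12 * x + b2 M) ^ 2 - c4 M"
    using T(1) by (metis dvd_add dvd_triv_left)
  have "c4 M * (12 * x + b2 M) + c6 M = (c4 M * T + c6 M) + int p * (c4 M * e)"
    unfolding x by Groebner_Basis.algebra
  then have X2: "int p dvd c4 M * (12 * x + b2 M) + c6 M"
    using T(2) by (metis dvd_add dvd_triv_left)
  have "2 ^ 3 * 3 ^ 1 * (6 * x ^ 2 + b2 M * x + b4 M) = (12 * x + b2 M) ^ 2 - c4 M"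
    unfolding c4_def by Groebner_Basis.algebra
  then have deriv: "int p dvd 6 * x ^ 2 + b2 M * x + b4 M"
    using X1 ndpow[of 3 1] pp prime_dvd_mult_iff by metis
  have "2 ^ 4 * 3 ^ 3 * (4 * x ^ 3 + b2 M * x ^ 2 + 2 * b4 M * x + b6 M) =
      (12 * x + b2 M) * ((12 * x + b2 M) ^ 2 - c4 M) - 2 * (c4 M * (12 * x + b2 M) + c6 M)"
    unfolding c4_def c6_def by Groebner_Basis.algebra
  then have "int p dvd 2 ^ 4 * 3 ^ 3 * (4 * x ^ 3 + b2 M * x ^ 2 + 2 * b4 M * x + b6 M)"
    using X1 X2 by (metis dvd_diff dvd_mult)
  then have "int p dvd 4 * x ^ 3 + b2 M * x ^ 2 + 2 * b4 M * x + b6 M"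
    using ndpow[of 4 3] pp prime_dvd_mult_iff by blast
  then show ?thesis using singular_point_mod_if_double_root[OF odd _ deriv] by blast
qed

lemma singular_point_mod_exists_iff:
  assumes "prime p"
  shows "(\<exists>x y. singular_point_mod p M x y) \<longleftrightarrow> int p dvd discriminant M"
proof
  show "int p dvd discriminant M" if "\<exists>x y. singular_point_mod p M x y"
    using that singular_point_mod_dvd_discriminant by blast
  show "\<exists>x y. singular_point_mod p M x y" if dvd: "int p dvd discriminant M"
  proof -
    consider "p = 2" | "p = 3" | "p \<noteq> 2" "p \<noteq> 3" by blast
    then show ?thesis
    proof cases
      case 1
      then show ?thesis using dvd singular_point_mod_2[of M] by simp
    next
      case 2
      then show ?thesis using dvd singular_point_mod_3[of M] by simp
    next
      case 3
      then show ?thesis using dvd singular_point_mod_ge_5[OF assms] by blast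
    qed
  qed
qed


section \<open>Reduction types and the conductor\<close>

text \<open>Good reduction is witnessed by some model minimal at \<open>p\<close>, perhaps not
  \<open>M\<close>; minimality of \<open>M\<close> carries a prime divisor \<open>p\<close> of its
  discriminant over to that model.\<close>

lemma good_reduction_iff:
  assumes ell: "elliptic_curve E" and M: "global_minimal_model E M" and p: "prime p"
  shows "good_reduction E p \<longleftrightarrow> \<not> int p dvd discriminant M"
proof
  have min: "minimal_model_at p E M" using M p by (simp add: global_minimal_model_def)
  show "good_reduction E p" if "\<not> int p dvd discriminant M"
    using that min singular_point_mod_exists_iff[OF p, of M] unfolding good_reduction_def by blast
  show "\<not> int p dvd discriminant M" if "good_reduction E p"
  proof
    assume dvd: "int p dvd discriminant M"
    from that obtain M' where M': "minimal_model_at p E M'"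
      and nsing: "\<not> (\<exists>x y. singular_point_mod p M' x y)"
      unfolding good_reduction_def by blast
    have "discriminant M \<noteq> 0"
      using integral_model_discriminant_nonzero ell min unfolding minimal_model_at_def by blast
    then have "multiplicity (int p) (discriminant M) > 0"
      using dvd p by (simp add: prime_multiplicity_gt_zero_iff)
    also have "multiplicity (int p) (discriminant M) \<le> multiplicity (int p) (discriminant M')"
      using min M' by (auto simp: minimal_model_at_def)
    finally have "int p dvd discriminant M'"
      by (metis not_dvd_imp_multiplicity_0 less_irrefl)
    then show False using nsing singular_point_mod_exists_iff[OF p] by blast
  qed
qed

lemma semistable_not_dvd_c4:
  assumes M: "global_minimal_model E M" and ss: "semistable E"
    and p: "prime p" and dvd: "int p dvd discriminant M"
  shows "\<not> int p dvd c4 M"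
proof
  assume "int p dvd c4 M"
  then have "\<exists>x y. cusp_mod p M x y"
    using singular_point_mod_is_cusp[OF p] singular_point_mod_exists_iff[OF p] dvd by blast
  then have "additive_reduction E p"
    using M p by (auto simp: additive_reduction_def global_minimal_model_def)
  then show False using ss p by (simp add: semistable_def)
qed

lemma semistable_conductor_exponent:
  assumes ell: "elliptic_curve E" and M: "global_minimal_model E M" and ss: "semistable E"
    and p: "prime p" and dvd: "int p dvd discriminant M"
  shows "conductor_exponent E p = 1"
proof -
  have min: "minimal_model_at p E M" using M p by (simp add: global_minimal_model_def)
  obtain x y where "singular_point_mod p M x y"
    using singular_point_mod_exists_iff[OF p] dvd by blast
  moreover have "\<not> cusp_mod p M x y"
    using min ss p by (auto simp: semistable_def additive_reduction_def)
  ultimately have "multiplicative_reduction E p"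
    using min by (auto simp: multiplicative_reduction_def node_mod_def)
  moreover have "\<not> good_reduction E p" using good_reduction_iff[OF ell M p] dvd by simp
  ultimately show ?thesis by (simp add: conductor_exponent_def)
qed

text \<open>The bad primes are those dividing the discriminant, and each has multiplicative
  reduction, hence exponent 1.\<close>

lemma semistable_conductor:
  assumes ell: "elliptic_curve E" and M: "global_minimal_model E M" and ss: "semistable E"
  shows "int (conductor E) = rad (discriminant M)"
proof -
  have nz: "discriminant M \<noteq> 0"
    using integral_model_discriminant_nonzero ell M by (auto simp: global_minimal_model_def)
  have "conductor E = (\<Prod>p | prime p \<and> int p dvd discriminant M. p)"
    unfolding conductor_def
    using good_reduction_iff[OF ell M] semistable_conductor_exponent[OF ell M ss]
    by (intro prod.cong) auto
  then have "int (conductor E) = (\<Prod>p | prime p \<and> int p dvd discriminant M. int p)"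
    by simp
  also have "\<dots> = \<Prod>(int ` {p. prime p \<and> int p dvd discriminant M})"
    by (simp add: prod.reindex inj_on_def)
  also have "int ` {p. prime p \<and> int p dvd discriminant M} = prime_factors (discriminant M)"
  proof (intro equalityI subsetI)
    fix q assume "q \<in> prime_factors (discriminant M)"
    then show "q \<in> int ` {p. prime p \<and> int p dvd discriminant M}"
      by (intro image_eqI[of _ _ "nat q"]) (auto simp: in_prime_factors_iff prime_ge_0_int)
  qed (use nz in \<open>auto simp: in_prime_factors_iff\<close>)
  finally show ?thesis by (simp add: rad_def)
qed


section \<open>Radicals\<close>

lemma rad_pos: "rad n > 0"
  unfolding rad_def by (intro prod_pos) (auto simp: in_prime_factors_iff prime_gt_0_int)

lemma rad_le_abs:
  assumes "n \<noteq> 0"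
  shows "rad n \<le> \<bar>n\<bar>"
proof -
  have "rad n \<le> (\<Prod>p\<in>prime_factors n. p ^ multiplicity p n)"
    unfolding rad_def
  proof (rule prod_mono)
    fix p assume "p \<in> prime_factors n"
    then have "prime p" "multiplicity p n > 0"
      using assms by (auto simp: prime_factors_multiplicity)
    then show "0 \<le> p \<and> p \<le> p ^ multiplicity p n"
      by (simp add: prime_ge_0_int prime_ge_1_int self_le_power)
  qed
  also have "\<dots> = \<bar>n\<bar>" using prod_prime_factors[OF assms] by simp
  finally show ?thesis .
qed

lemma rad_mono_dvd:
  assumes "m dvd n" "n \<noteq> 0"
  shows "rad m \<le> rad n"
  unfolding rad_def
  by (rule prod_mono2)
    (use assms in \<open>auto simp: in_prime_factors_iff dest: prime_ge_1_int prime_ge_0_int intro: dvd_trans\<close>)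

text \<open>The right-hand side counts the elements of \<open>A \<inter> B\<close> twice, and their
  product is at least 1.\<close>

lemma prod_Un_le:
  fixes A B :: "int set"
  assumes "finite A" "finite B" "\<And>x. x \<in> A \<union> B \<Longrightarrow> 1 \<le> x"
  shows "\<Prod>(A \<union> B) \<le> \<Prod>A * \<Prod>B"
proof -
  have "\<Prod>(A \<union> B) * 1 \<le> \<Prod>(A \<union> B) * \<Prod>(A \<inter> B)"
    using assms
    by (intro mult_left_mono prod_ge_1 prod_nonneg) (auto intro: order_trans[OF zero_le_one])
  also have "\<dots> = \<Prod>A * \<Prod>B" using assms by (simp add: prod.union_inter)
  finally show ?thesis by simp
qed

lemma rad_mult_le:
  assumes "a \<noteq> 0" "b \<noteq> 0"
  shows "rad (a * b) \<le> rad a * rad b"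
  unfolding rad_def using assms
  by (subst prime_factors_product) (auto intro!: prod_Un_le simp: in_prime_factors_iff prime_ge_1_int)

lemma rad_power:
  assumes "k > 0"
  shows "rad (n ^ k) = rad n"
  unfolding rad_def using assms by (simp add: prime_factors_power)

theorem lemma2:
  fixes E :: "rat weierstrass" and M :: "int weierstrass"
  assumes "elliptic_curve E"
    and "good_elliptic_curve E"
    and "semistable E"
    and "[minimal_discriminant E = 0] (mod 6)"
    and "global_minimal_model E M"
  shows "good_abc_triple (1728 * minimal_discriminant E) (c6 M ^ 2) (c4 M ^ 3)"
proof -
  define D where "D = discriminant M"
  define m where "m = max \<bar>c4 M ^ 3\<bar> (c6 M ^ 2)"
  have D: "minimal_discriminant E = D"
    using minimal_discriminant_eq assms by (simp add: D_def)
  have nz: "D \<noteq> 0"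
    using integral_model_discriminant_nonzero assms by (auto simp: D_def global_minimal_model_def)
  have six: "6 dvd D" using assms(4) by (simp add: D cong_0_iff)
  have sum: "1728 * D + c6 M ^ 2 = c4 M ^ 3"
    using discriminant_c4_c6[of M] by (simp add: D_def)
  \<comment> \<open>Goodness supplies its own minimal model; its \<open>c4\<close> and
    \<open>c6\<close> agree with those of \<open>M\<close> by uniqueness.\<close>
  obtain M' where "global_minimal_model E M'"
    "int (conductor E) ^ 6 < max \<bar>c4 M' ^ 3\<bar> (c6 M' ^ 2)"
    using assms(2) by (auto simp: good_elliptic_curve_def)
  then have small: "rad D ^ 6 < m"
    using global_minimal_model_unique[OF assms(1) assms(5)] semistable_conductor[OF assms(1,5,3)]
    by (simp add: D_def m_def)

  have "Gcd {1728 * D, c6 M ^ 2, c4 M ^ 3} = 1"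
  proof (rule ccontr)
    assume "Gcd {1728 * D, c6 M ^ 2, c4 M ^ 3} \<noteq> 1"
    then have "\<not> is_unit (Gcd {1728 * D, c6 M ^ 2, c4 M ^ 3})" by auto
    moreover have "Gcd {1728 * D, c6 M ^ 2, c4 M ^ 3} \<noteq> 0" using nz by simp
    ultimately obtain q where q: "prime q" "q dvd Gcd {1728 * D, c6 M ^ 2, c4 M ^ 3}"
      using prime_divisor_exists by blast
    then have "q dvd 1728 * D" "q dvd c4 M ^ 3" by (meson Gcd_dvd dvd_trans insertCI)+
    have "q dvd c4 M" using \<open>q dvd c4 M ^ 3\<close> q prime_dvd_power by blast
    \<comment> \<open>Since \<open>1728 = 2^6 * 3^3\<close>, a prime dividing it divides 6 and hence
      \<open>D\<close>. So \<open>q\<close> divides both \<open>D\<close> and \<open>c4\<close>,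
      against semistability.\<close>
    have "1728 * D dvd 6 ^ 6 * D" by (intro mult_dvd_mono) simp_all
    with \<open>q dvd 1728 * D\<close> have "q dvd 6 ^ 6 * D" by (rule dvd_trans)
    then have "q dvd 6 \<or> q dvd D" using q prime_dvd_mult_iff prime_dvd_power by blast
    then have "q dvd D" using six dvd_trans by blast
    moreover have "int (nat q) = q" "prime (nat q)" using q by (auto simp: prime_ge_0_int)
    ultimately show False
      using semistable_not_dvd_c4[OF assms(5,3), of "nat q"] \<open>q dvd c4 M\<close> by (simp add: D_def)
  qed
  with sum have abc: "abc_triple (1728 * D) (c6 M ^ 2) (c4 M ^ 3)"
    by (simp add: abc_triple_def)

  have "rad (1728 * D * c6 M ^ 2 * c4 M ^ 3) < Max {\<bar>1728 * D\<bar>, \<bar>c6 M ^ 2\<bar>, \<bar>c4 M ^ 3\<bar>}"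
  proof (cases "c4 M = 0 \<or> c6 M = 0")
    case True
    \<comment> \<open>The product is 0, whose radical is the empty product.\<close>
    then have "rad (1728 * D * c6 M ^ 2 * c4 M ^ 3) = 1" by (auto simp: rad_def)
    also have "1 < \<bar>1728 * D\<bar>" using nz by linarith
    also have "\<dots> \<le> Max {\<bar>1728 * D\<bar>, \<bar>c6 M ^ 2\<bar>, \<bar>c4 M ^ 3\<bar>}" by simp
    finally show ?thesis .
  next
    case False
    then have c: "c4 M \<noteq> 0" "c6 M \<noteq> 0" by auto
    have "(1728::int) dvd 6 ^ 6" by simp
    also have "6 ^ 6 dvd D ^ 6" using six by (rule dvd_power_same)
    finally have "1728 * D dvd D ^ 6 * D" by (rule mult_dvd_mono) simp
    then have "1728 * D dvd D ^ 7" by (simp add: power_Suc2 [symmetric] del: power_Suc)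
    then have rD: "rad (1728 * D) \<le> rad D"
      using rad_mono_dvd[of "1728 * D" "D ^ 7"] nz by (simp add: rad_power)
    have "rad (1728 * D * c6 M ^ 2 * c4 M ^ 3) \<le> rad (1728 * D * c6 M ^ 2) * rad (c4 M ^ 3)"
      using nz c by (intro rad_mult_le) auto
    also have "\<dots> \<le> rad (1728 * D) * rad (c6 M ^ 2) * rad (c4 M ^ 3)"
      using nz c by (intro mult_right_mono rad_mult_le) (auto intro: less_imp_le rad_pos)
    also have "\<dots> = rad (1728 * D) * rad (c6 M) * rad (c4 M)" by (simp add: rad_power)
    also have "\<dots> \<le> rad D * \<bar>c6 M\<bar> * \<bar>c4 M\<bar>"
      using rD c by (intro mult_mono rad_le_abs mult_nonneg_nonneg)
        (auto intro: less_imp_le[OF rad_pos])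
    also have "\<dots> < m"
    proof (rule power_less_imp_less_base)
      \<comment> \<open>Sixth powers clear the roots: the three factors are bounded by
        \<open>m\<close>, \<open>m^3\<close> and \<open>m^2\<close>. As \<open>c4\<close> and
        \<open>c6\<close> are nonzero, the strict bound on \<open>rad D ^ 6\<close> survives
        multiplication.\<close>
      have "(rad D * \<bar>c6 M\<bar> * \<bar>c4 M\<bar>) ^ 6 = rad D ^ 6 * ((c6 M ^ 2) ^ 3 * \<bar>c4 M ^ 3\<bar> ^ 2)"
        by (simp add: power_mult_distrib power_abs flip: power_mult)
      also have "\<dots> < m * ((c6 M ^ 2) ^ 3 * \<bar>c4 M ^ 3\<bar> ^ 2)"
        using small c by (intro mult_strict_right_mono) auto
      also have "\<dots> \<le> m * (m ^ 3 * m ^ 2)"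
        by (intro mult_left_mono mult_mono power_mono) (auto simp: m_def)
      also have "\<dots> = m ^ 6" by Groebner_Basis.algebra
      finally show "(rad D * \<bar>c6 M\<bar> * \<bar>c4 M\<bar>) ^ 6 < m ^ 6" .
    qed (simp add: m_def)
    also have "m \<le> Max {\<bar>1728 * D\<bar>, \<bar>c6 M ^ 2\<bar>, \<bar>c4 M ^ 3\<bar>}" by (auto simp: m_def)
    finally show ?thesis .
  qed
  with abc show ?thesis by (simp add: good_abc_triple_def D)
qed

end
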